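(* Let $p$ be analytic in $\mathbb{D}$ with $p(0)=1$, and let $\beta$ be a complex number with $\operatorname{Re}\beta>0$. If $$p^2(z)+\beta zp'(z)p(z)\prec 1+z,$$ then $p(z)\prec\sqrt{1+z}$.
   Context: $\mathbb{D}=\{z\in\mathbb{C}:|z|<1\}$; $p^k(z)=(p(z))^k$. For analytic $f,g$ on $\mathbb{D}$, $f\prec g$ ($f$ is subordinate to $g$) means there is an analytic $w:\mathbb{D}\to\mathbb{D}$ with $w(0)=0$ and $f(z)=g(w(z))$ for all $z\in\mathbb{D}$. $\sqrt{1+z}$ is the principal branch; it maps $\mathbb{D}$ univalently onto $\{w:|w^2-1|<1,\ \operatorname{Re}w>0\}$. *)

theory Defs
  imports "HOL-Complex_Analysis.Complex_Analysis"
begin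

text \<open>Subordination is only defined for analytic functions on the unit disc, so the
  analyticity of both functions is part of the definition.\<close>

definition subordinate :: "(complex \<Rightarrow> complex) \<Rightarrow> (complex \<Rightarrow> complex) \<Rightarrow> bool"
  (infix "\<prec>\<^sub>D" 50) where
  "f \<prec>\<^sub>D g \<longleftrightarrow>
     f holomorphic_on ball 0 1 \<and> g holomorphic_on ball 0 1 \<and>
     (\<exists>w. w holomorphic_on ball 0 1 \<and> w ` ball 0 1 \<subseteq> ball 0 1 \<and> w 0 = 0 \<and>
          (\<forall>z\<in>ball 0 1. f z = g (w z)))"

end

theory Submission
  imports Defs
begin

text \<open>Write \<open>p\<^sup>2 = 1 + \<omega>\<close>; the hypothesis becomes \<open>\<omega> + (\<beta>/2) z \<omega>' = w\<close> with \<open>|w| < 1\<close>. At a point \<open>\<zeta>\<close>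
  where \<open>|\<omega>|\<close> is maximal on a closed disc, moving \<open>\<zeta>\<close> inwards along the logarithmic spiral
  \<open>\<zeta> exp (\<beta>t)\<close>, \<open>t \<le> 0\<close>, cannot increase \<open>|\<omega>|\<close>, so \<open>Re (cnj \<omega> \<beta> \<zeta> \<omega>') \<ge> 0\<close> and hence
  \<open>|\<omega>| \<le> |w| < 1\<close> there. Thus \<open>p\<^sup>2\<close> stays in the disc about 1 of radius 1, and \<open>p\<close> is its principal root
  by connectedness.\<close>

lemma spiral_derivative_nonneg:
  fixes f :: "complex \<Rightarrow> complex" and \<beta> \<zeta> f' :: complex
  assumes der: "(f has_field_derivative f') (at \<zeta>)"
    and max: "\<And>z. norm z \<le> norm \<zeta> \<Longrightarrow> norm (f z) \<le> norm (f \<zeta>)"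
    and \<beta>: "Re \<beta> > 0"
  shows "f \<zeta> \<bullet> (\<beta> * \<zeta> * f') \<ge> 0"
proof (rule ccontr)
  assume neg: "\<not> ?thesis"
  define s where "s t = \<zeta> * exp (\<beta> * of_real t)" for t :: real
  have "(s has_vector_derivative (\<beta> * \<zeta>)) (at 0)"
    unfolding s_def
    by (rule has_vector_derivative_real_field) (auto intro!: derivative_eq_intros)
  then have "(f \<circ> s has_vector_derivative (\<beta> * \<zeta> * f')) (at 0)"
    using field_vector_diff_chain_at[of s "\<beta> * \<zeta>" 0 f f'] der by (simp add: s_def)
  \<comment> \<open>The squared norm is differentiable even where \<open>f\<close> vanishes; the
    norm itself need not be.\<close>
  then have "((\<lambda>t. (f \<circ> s) t \<bullet> (f \<circ> s) t) has_derivative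
      (\<lambda>h. (f \<circ> s) 0 \<bullet> (h *\<^sub>R (\<beta> * \<zeta> * f')) + (h *\<^sub>R (\<beta> * \<zeta> * f')) \<bullet> (f \<circ> s) 0)) (at 0)"
    unfolding has_vector_derivative_def by (intro has_derivative_inner)
  then have "((\<lambda>t. (norm (f (s t)))\<^sup>2) has_real_derivative 2 * (f \<zeta> \<bullet> (\<beta> * \<zeta> * f'))) (at 0)"
    unfolding has_field_derivative_def
    by (simp add: s_def power2_norm_eq_inner inner_commute[of _ "f \<zeta>"] mult.assoc mult.left_commute
        mult_commute_abs o_def)
  from DERIV_neg_dec_left[OF this] neg obtain d where "d > 0"
    and d: "\<And>h. 0 < h \<Longrightarrow> h < d \<Longrightarrow> (norm (f (s 0)))\<^sup>2 < (norm (f (s (0 - h))))\<^sup>2"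
    by auto
  then have "norm (f \<zeta>) < norm (f (s (0 - d / 2)))"
    using d[of "d / 2"] by (auto simp: s_def intro: power2_less_imp_less)
  \<comment> \<open>\<open>norm (s t)\<close> equals
    \<open>norm \<zeta> * exp (Re \<beta> * t)\<close>, which increases with \<open>t\<close>, so
    earlier times lie in the disc where \<open>max\<close> applies.\<close>
  moreover have "norm (s (0 - d / 2)) \<le> norm \<zeta>"
    using \<open>d > 0\<close> \<beta> by (simp add: s_def norm_mult mult_left_le)
  ultimately show False using max by fastforce
qed

lemma euler_operator_norm_less_1:
  fixes f :: "complex \<Rightarrow> complex" and \<beta> z :: complex
  assumes holo: "f holomorphic_on ball 0 1" and \<beta>: "Re \<beta> > 0"
    and bound: "\<And>z. norm z < 1 \<Longrightarrow> norm (f z + \<beta> * z * deriv f z) < 1"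
    and z: "norm z < 1"
  shows "norm (f z) < 1"
proof -
  have "continuous_on (cball 0 (norm z)) (\<lambda>x. norm (f x))"
    using z by (intro continuous_intros holomorphic_on_imp_continuous_on
        holomorphic_on_subset[OF holo]) auto
  then obtain \<zeta> where \<zeta>: "norm \<zeta> \<le> norm z"
    and max: "\<And>x. norm x \<le> norm z \<Longrightarrow> norm (f x) \<le> norm (f \<zeta>)"
    using continuous_attains_sup[of "cball 0 (norm z)" "\<lambda>x. norm (f x)"] by auto
  have "norm \<zeta> < 1" using \<zeta> z by simp
  then have "(f has_field_derivative deriv f \<zeta>) (at \<zeta>)"
    by (intro holomorphic_derivI[OF holo]) auto
  \<comment> \<open>The maximiser may be interior to the disc of radius \<open>norm z\<close>. This
    is harmless, since the spiral only visits points of modulus at most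
    \<open>norm \<zeta>\<close>.\<close>
  then have "f \<zeta> \<bullet> (\<beta> * \<zeta> * deriv f \<zeta>) \<ge> 0"
    using max \<zeta> \<beta> by (intro spiral_derivative_nonneg) auto
  then have "(norm (f \<zeta>))\<^sup>2 \<le> f \<zeta> \<bullet> (f \<zeta> + \<beta> * \<zeta> * deriv f \<zeta>)"
    by (simp add: inner_add_right power2_norm_eq_inner)
  also have "\<dots> \<le> norm (f \<zeta>) * norm (f \<zeta> + \<beta> * \<zeta> * deriv f \<zeta>)"
    by (rule norm_cauchy_schwarz)
  finally have "norm (f \<zeta>) \<le> norm (f \<zeta> + \<beta> * \<zeta> * deriv f \<zeta>) \<or> f \<zeta> = 0"
    by (auto simp: power2_eq_square mult_le_cancel_left)
  then have "norm (f \<zeta>) < 1"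
    using bound[OF \<open>norm \<zeta> < 1\<close>] by auto
  then show ?thesis using max[of z] by simp
qed

lemma Re_one_plus_pos: "norm w < 1 \<Longrightarrow> Re (1 + w) > 0"
  using abs_Re_le_cmod[of w] by simp

text \<open>Subordination demands analyticity of the right-hand function too. The branch cut is
  avoided because 1 + z stays in the right half-plane.\<close>

lemma csqrt_one_plus_holomorphic: "(\<lambda>z. csqrt (1 + z)) holomorphic_on ball 0 1"
  using Re_one_plus_pos
  by (intro holomorphic_intros) (fastforce simp: complex_nonpos_Reals_iff)

lemma csqrt_one_plus_eqI:
  fixes p w :: "complex \<Rightarrow> complex"
  assumes p: "continuous_on S p" and w: "continuous_on S w" and S: "connected S"
    and w1: "\<And>z. z \<in> S \<Longrightarrow> norm (w z) < 1"
    and sq: "\<And>z. z \<in> S \<Longrightarrow> (p z)\<^sup>2 = 1 + w z"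
    and a: "a \<in> S" "Re (p a) > 0" and z: "z \<in> S"
  shows "p z = csqrt (1 + w z)"
proof -
  \<comment> \<open>A purely imaginary value would have a real square that is at most 0, but 1 + w
    lies in the right half-plane. So \<open>Re (p x)\<close> cannot change sign on \<open>S\<close>,
    and \<open>csqrt\<close> is the root with positive real part.\<close>
  have nz: "Re (p x) \<noteq> 0" if "x \<in> S" for x
    using Re_one_plus_pos[OF w1[OF that]] sq[OF that, symmetric]
    by (auto simp: power2_eq_square)
  have conn: "connected ((\<lambda>x. Re (p x)) ` S)"
    by (intro connected_continuous_image continuous_intros p S)
  have "Re (p z) > 0"
  proof (rule ccontr)
    assume "\<not> Re (p z) > 0"
    then have "0 \<in> (\<lambda>x. Re (p x)) ` S"
      using connectedD_interval[OF conn, of "Re (p z)" "Re (p a)" 0] a z by auto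
    then show False using nz by auto
  qed
  then show ?thesis
    using sq[OF z, symmetric] by (simp add: csqrt_square)
qed

theorem lemma3p5:
  fixes p :: "complex \<Rightarrow> complex" and \<beta> :: complex
  assumes "p holomorphic_on ball 0 1"
    and "p 0 = 1"
    and "Re \<beta> > 0"
    and "(\<lambda>z. (p z)^2 + \<beta> * z * deriv p z * p z) \<prec>\<^sub>D (\<lambda>z. 1 + z)"
  shows "p \<prec>\<^sub>D (\<lambda>z. csqrt (1 + z))"
proof -
  define \<omega> where "\<omega> z = (p z)\<^sup>2 - 1" for z
  have \<omega>: "\<omega> holomorphic_on ball 0 1"
    unfolding \<omega>_def by (intro holomorphic_intros assms(1))
  \<comment> \<open>The half absorbs the factor 2 in the derivative 2 p p' of the square. The left
    side is then the hypothesis minus 1, that is, the self-map of the disc given by the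
    subordination.\<close>
  have "norm (\<omega> z + \<beta> / 2 * z * deriv \<omega> z) < 1" if z: "norm z < 1" for z
  proof -
    have "(p has_field_derivative deriv p z) (at z)"
      using z by (intro holomorphic_derivI[OF assms(1)]) auto
    then have "(\<omega> has_field_derivative 2 * p z * deriv p z) (at z)"
      unfolding \<omega>_def by (auto intro!: derivative_eq_intros)
    then have "\<omega> z + \<beta> / 2 * z * deriv \<omega> z = (p z)^2 + \<beta> * z * deriv p z * p z - 1"
      by (simp add: DERIV_imp_deriv \<omega>_def)
    then show ?thesis
      using assms(4) z unfolding subordinate_def by (auto simp: image_subset_iff)
  qed
  then have small: "norm (\<omega> z) < 1" if "norm z < 1" for z
    using euler_operator_norm_less_1[OF \<omega>, of "\<beta> / 2"] assms(3) that by simp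
  have root: "p z = csqrt (1 + \<omega> z)" if "z \<in> ball 0 1" for z
  proof (rule csqrt_one_plus_eqI[where S = "ball 0 1" and w = \<omega> and a = 0])
    show "continuous_on (ball 0 1) p" "continuous_on (ball 0 1) \<omega>"
      using assms(1) \<omega> by (simp_all add: holomorphic_on_imp_continuous_on)
  qed (use that small assms(2) in \<open>auto simp: \<omega>_def\<close>)
  \<comment> \<open>The witness for the subordination is \<open>\<omega>\<close> itself.\<close>
  have "\<omega> 0 = 0"
    by (simp add: \<omega>_def assms(2))
  moreover have "\<omega> ` ball 0 1 \<subseteq> ball 0 1"
    using small by auto
  ultimately show ?thesis
    unfolding subordinate_def using assms(1) \<omega> csqrt_one_plus_holomorphic root by blast
qed

end
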